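(* Let $r\ge1$ and $d\ge0$ be integers. The limit as $n\to\infty$ of the probability that the $r$th up-step (respectively, $r$th down-step) in a random Dyck path of semilength $n$ has height $d$ exists. Denoting this limit by $p_{r,d}$ (respectively, $p'_{r,d}$), we have $$\sum_{r\ge1}\sum_{d\ge0} p_{r,d}\, x^r y^d =\frac{xy(4-4y+xy^2)}{2(1-y)(1+\sqrt{1 - x})- 3 x y + 4xy^2 - x^2 y^3},$$ $$\sum_{r\ge1}\sum_{d\ge0} p'_{r,d}\, x^r y^d=\frac{xy}{2(1-y)(1+\sqrt{1 - x})-x+y^2}.$$
   Context: A Dyck path of semilength $n$ is a lattice path in $\mathbb Z^2$ with up-steps $(1,1)$ and down-steps $(1,-1)$ that starts at $(0,0)$, ends at $(2n,0)$, and never goes below the $x$-axis. The height of a step is the $y$-coordinate of its highest point. The up-steps of a path of semilength $n$ are indexed $1,\dots,n$ from left to right, and likewise the down-steps are indexed $1,\dots,n$ from left to right. A random Dyck path of semilength $n$ is chosen uniformly among all of them (with $n\ge r$). The identities are between formal power series in $x,y$. *)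

theory Defs
  imports
    "HOL-Probability.Probability_Mass_Function"
    "HOL-Computational_Algebra.Formal_Power_Series"
begin

datatype step = Up | Down

primrec step_vec :: "step \<Rightarrow> int \<times> int" where
  "step_vec Up = (1, 1)"
| "step_vec Down = (1, -1)"

text \<open>A path starting at the origin is encoded by its list of steps; \<open>path_point w i\<close> is the
  lattice point reached after the first \<open>i\<close> steps.\<close>

definition path_point :: "step list \<Rightarrow> nat \<Rightarrow> int \<times> int" where
  "path_point w i = (\<Sum>s\<leftarrow>take i w. step_vec s)"

definition dyck_paths :: "nat \<Rightarrow> step list set" where
  "dyck_paths n = {w. path_point w (length w) = (2 * int n, 0) \<and>
                      (\<forall>i\<le>length w. snd (path_point w i) \<ge> 0)}"

text \<open>Positions in the list are counted from 0, so the step \<open>w ! i\<close> joins \<open>path_point w i\<close>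
  to \<open>path_point w (Suc i)\<close>.\<close>

definition step_height :: "step list \<Rightarrow> nat \<Rightarrow> int" where
  "step_height w i = max (snd (path_point w i)) (snd (path_point w (Suc i)))"

text \<open>\<open>w ! i\<close> is the \<open>r\<close>-th step of kind \<open>s\<close> from the left, counting from 1.\<close>

definition is_nth_step :: "step \<Rightarrow> nat \<Rightarrow> step list \<Rightarrow> nat \<Rightarrow> bool" where
  "is_nth_step s r w i \<longleftrightarrow> i < length w \<and> w ! i = s \<and> card {j. j \<le> i \<and> w ! j = s} = r"

text \<open>The probability that the \<open>r\<close>-th step of kind \<open>s\<close> of a uniformly random Dyck path of
  semilength \<open>n\<close> has height \<open>d\<close>.  It is meant for \<open>1 \<le> r \<le> n\<close> (and is 0 if \<open>r > n\<close>, when there is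
  no such step).\<close>

definition step_height_prob :: "step \<Rightarrow> nat \<Rightarrow> nat \<Rightarrow> nat \<Rightarrow> real" where
  "step_height_prob s r d n =
     measure_pmf.prob (pmf_of_set (dyck_paths n))
       {w. \<exists>i. is_nth_step s r w i \<and> step_height w i = int d}"

definition limit_height_prob :: "step \<Rightarrow> nat \<Rightarrow> nat \<Rightarrow> real" where
  "limit_height_prob s r d = lim (\<lambda>n. step_height_prob s r d n)"

text \<open>Power series in \<open>x, y\<close> are represented as power series in \<open>x\<close> whose coefficients are power
  series in \<open>y\<close>.\<close>

definition xvar :: "real fps fps" where
  "xvar = fps_X"

definition yvar :: "real fps fps" where
  "yvar = fps_const fps_X"

definition height_gf :: "step \<Rightarrow> real fps fps" where
  "height_gf s = Abs_fps (\<lambda>r. Abs_fps (\<lambda>d. if r \<ge> 1 then limit_height_prob s r d else 0))"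

text \<open>The root of \<open>1 - x\<close> with constant term 1, taken in \<open>real fps\<close> and then lifted
  coefficientwise, since \<open>fps_radical\<close> needs coefficients in a field.\<close>

definition sqrt_one_minus_x :: "real fps fps" where
  "sqrt_one_minus_x = Abs_fps (\<lambda>k. fps_const (fps_nth (fps_radical root 2 (1 - fps_X)) k))"

lemma sqrt_one_minus_x_nth_0: "fps_nth sqrt_one_minus_x 0 = 1"
  by (simp add: sqrt_one_minus_x_def)

lemma sqrt_one_minus_x_squared: "sqrt_one_minus_x ^ 2 = 1 - xvar"
proof -
  define g :: "real fps" where "g = fps_radical root 2 (1 - fps_X)"
  have g: "g ^ 2 = 1 - fps_X"
    using power_radical[of "1 - fps_X :: real fps" root 1]
    by (simp add: g_def numeral_2_eq_2)
  have "fps_nth (sqrt_one_minus_x ^ 2) k = fps_const (fps_nth (g ^ 2) k)" for k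
  proof -
    have *: "(\<Sum>i\<in>A. fps_const (f i)) = fps_const (\<Sum>i\<in>A. f i)" for f :: "nat \<Rightarrow> real" and A
      by (induction A rule: infinite_finite_induct) auto
    show ?thesis
      by (simp add: sqrt_one_minus_x_def g_def power2_eq_square fps_mult_nth *)
  qed
  thus ?thesis unfolding g
    by (intro fps_ext) (simp add: xvar_def fps_X_def flip: fps_const_sub)
qed

text \<open>Division by a series with nonzero constant term is genuine division.\<close>

lemma fps_fps_divide_mult_cancel:
  fixes f g :: "real fps fps"
  assumes "fps_nth (fps_nth g 0) 0 \<noteq> 0"
  shows "f / g * g = f"
proof -
  have g0: "fps_nth g 0 \<noteq> 0" using assms by auto
  have "fps_nth g 0 * inverse (fps_nth g 0) = 1"
    using inverse_mult_eq_1[OF assms] by (simp add: mult.commute)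
  hence "g * inverse g = 1"
    unfolding fps_inverse_def by (rule fps_right_inverse)
  hence "inverse g * g = 1" by (simp add: mult.commute)
  moreover have "f / g = f * inverse g"
    using g0 by (intro fps_divide_unit') auto
  ultimately show ?thesis
    by (simp add: mult.assoc)
qed

text \<open>The uniform distribution on Dyck paths of semilength \<open>n\<close> is well-defined.\<close>

lemma length_dyck_path:
  assumes "w \<in> dyck_paths n"
  shows "length w = 2 * n"
proof -
  have "fst (sum_list (map step_vec v)) = int (length v)" for v
  proof (induction v)
    case (Cons s v)
    thus ?case by (cases s) auto
  qed simp
  from this[of w] show ?thesis
    using assms by (auto simp: dyck_paths_def path_point_def)
qed

lemma finite_dyck_paths: "finite (dyck_paths n)"
proof -
  have "finite {w. set w \<subseteq> {Up, Down} \<and> length w = 2 * n}"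
    by (intro finite_lists_length_eq) auto
  moreover have "dyck_paths n \<subseteq> {w. set w \<subseteq> {Up, Down} \<and> length w = 2 * n}"
    using length_dyck_path step.exhaust by blast
  ultimately show ?thesis by (rule finite_subset[rotated])
qed

lemma dyck_paths_nonempty: "dyck_paths n \<noteq> {}"
proof -
  have rep: "sum_list (replicate m (1, 1)) = (int m, int m)"
            "sum_list (replicate m (1, - 1)) = (int m, - int m)" for m
    by (induction m) (auto simp: zero_prod_def)
  have "replicate n Up @ replicate n Down \<in> dyck_paths n"
    by (auto simp: dyck_paths_def path_point_def rep)
  thus ?thesis by blast
qed

end

theory Submission
  imports Defs
begin

text \<open>
  Cut a Dyck path at the marked step. Before the step comes a word that stays nonnegative, and its
  numbers of up- and down-steps are both determined by \<open>r\<close> and \<open>d\<close>. After the step comes a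
  completion back to the axis. For fixed \<open>r\<close> and \<open>d\<close> the probability is therefore a fixed ballot
  number times the number of completions, divided by the Catalan number; no infinite sum over cut
  positions occurs. If the path stands at height \<open>h\<close> after \<open>m\<close> steps, the share of Dyck paths
  that continue a given such beginning tends to \<open>(h + 1) / 2^m\<close> (\<open>completions_tendsto\<close>). Hence,
  with \<open>b h k\<close> the number of nonnegative words with \<open>h + k\<close> up-steps and \<open>k\<close> down-steps
  (\<open>ballot\<close>),

    \<open>p r d = b (d - 1) (r - d) (d + 1) / 2^(2r - d)\<close> for \<open>1 \<le> d \<le> r\<close>,
    \<open>p' r d = b d (r - 1) d / 2^(d + 2r - 1)\<close>.

  The series of \<open>b h k z^k\<close> over \<open>k\<close> is the \<open>(h + 1)\<close>-st power of the Catalan series \<open>C(z)\<close>.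
  The powers of 2 amount to \<open>z = x / 4\<close>, where \<open>C(x / 4) = 2 / (1 + s)\<close> with \<open>s = sqrt (1 - x)\<close>
  (\<open>cat_fps_power_nth\<close>). For each \<open>d\<close> the sum over \<open>r\<close> is thus \<open>(d + 1) t^d\<close> with
  \<open>t = x / (1 + s) = 1 - s\<close> for up-steps with \<open>d > 0\<close>, and \<open>x c * d c^d\<close> with
  \<open>c = 1 / (1 + s)\<close> for down-steps. Summing these over \<open>d\<close> against \<open>y^d\<close> gives

    \<open>1 / (1 - y (1 - s))^2 - 1\<close>  and  \<open>x y / (1 + s - y)^2\<close>,

  and both right-hand sides of the theorem reduce to these by \<open>x = (1 - s) (1 + s)\<close>.
\<close>

section \<open>Counting words that stay nonnegative\<close>

abbreviation ups :: "step list \<Rightarrow> nat" where "ups w \<equiv> count_list w Up"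
abbreviation downs :: "step list \<Rightarrow> nat" where "downs w \<equiv> count_list w Down"

text \<open>The starting height \<open>a\<close> is a parameter so that both halves of a Dyck path cut at a step, the second
of which starts above the axis, are words of the same kind.\<close>

fun stays_nonneg :: "nat \<Rightarrow> step list \<Rightarrow> bool" where
  "stays_nonneg a [] \<longleftrightarrow> True"
| "stays_nonneg a (Up # w) \<longleftrightarrow> stays_nonneg (Suc a) w"
| "stays_nonneg a (Down # w) \<longleftrightarrow> 0 < a \<and> stays_nonneg (a - 1) w"

definition nonneg_paths :: "nat \<Rightarrow> nat \<Rightarrow> nat \<Rightarrow> step list set" where
  "nonneg_paths a u k = {w. ups w = u \<and> downs w = k \<and> stays_nonneg a w}"

lemma length_eq_ups_plus_downs: "length w = ups w + downs w"
proof (induction w)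
  case (Cons s w)
  thus ?case by (cases s) auto
qed simp

lemma finite_nonneg_paths: "finite (nonneg_paths a u k)"
proof -
  have "finite {w. set w \<subseteq> {Up, Down} \<and> length w = u + k}"
    by (intro finite_lists_length_eq) auto
  moreover have "nonneg_paths a u k \<subseteq> {w. set w \<subseteq> {Up, Down} \<and> length w = u + k}"
    using step.exhaust by (auto simp: nonneg_paths_def length_eq_ups_plus_downs)
  ultimately show ?thesis by (rule finite_subset[rotated])
qed

lemma stays_nonneg_append:
  "stays_nonneg a (v @ x) \<longleftrightarrow> stays_nonneg a v \<and> stays_nonneg (a + ups v - downs v) x"
proof (induction a v rule: stays_nonneg.induct)
  case (3 a w)
  thus ?case by (cases a) auto
qed auto

lemma downs_le_if_stays_nonneg: "stays_nonneg a w \<Longrightarrow> downs w \<le> a + ups w"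
  by (induction a w rule: stays_nonneg.induct) auto

text \<open>Links the recursion on the first step, which suits counting, to the condition on all prefixes that
defines Dyck paths.\<close>

lemma stays_nonneg_iff_prefixes:
  "stays_nonneg a w \<longleftrightarrow> (\<forall>i\<le>length w. downs (take i w) \<le> a + ups (take i w))"
proof
  assume "stays_nonneg a w"
  thus "\<forall>i\<le>length w. downs (take i w) \<le> a + ups (take i w)"
    using downs_le_if_stays_nonneg stays_nonneg_append by (metis append_take_drop_id)
next
  show "\<forall>i\<le>length w. downs (take i w) \<le> a + ups (take i w) \<Longrightarrow> stays_nonneg a w"
  proof (induction a w rule: stays_nonneg.induct)
    case (2 a w)
    have "downs (take i w) \<le> Suc a + ups (take i w)" if "i \<le> length w" for i
      using 2(2)[rule_format, of "Suc i"] that by simp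
    thus ?case using 2(1) by simp
  next
    case (3 a w)
    have "0 < a" using 3(2)[rule_format, of 1] by simp
    have "downs (take i w) \<le> a - 1 + ups (take i w)" if "i \<le> length w" for i
      using 3(2)[rule_format, of "Suc i"] that by simp
    thus ?case using 3(1) \<open>0 < a\<close> by simp
  qed auto
qed

lemma path_point_eq:
  "i \<le> length w \<Longrightarrow> path_point w i = (int i, int (ups (take i w)) - int (downs (take i w)))"
proof -
  have "(\<Sum>s\<leftarrow>v. step_vec s) = (int (length v), int (ups v) - int (downs v))" for v
  proof (induction v)
    case (Cons s v)
    thus ?case by (cases s) auto
  qed (simp add: zero_prod_def)
  thus "i \<le> length w \<Longrightarrow> ?thesis" by (simp add: path_point_def)
qed

lemma dyck_paths_eq: "dyck_paths n = nonneg_paths 0 n n"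
proof -
  have "w \<in> dyck_paths n \<longleftrightarrow> w \<in> nonneg_paths 0 n n" for w
  proof -
    have "path_point w (length w) = (2 * int n, 0) \<longleftrightarrow> ups w = n \<and> downs w = n"
      by (auto simp: path_point_eq length_eq_ups_plus_downs)
    moreover have "(\<forall>i\<le>length w. snd (path_point w i) \<ge> 0) \<longleftrightarrow> stays_nonneg 0 w"
      unfolding stays_nonneg_iff_prefixes by (simp add: path_point_eq)
    ultimately show ?thesis by (auto simp: dyck_paths_def nonneg_paths_def)
  qed
  thus ?thesis by blast
qed

lemma nonneg_paths_no_ups:
  "nonneg_paths a 0 k = (if k \<le> a then {replicate k Down} else {})"
proof -
  have *: "ups w = 0 \<and> downs w = m \<longleftrightarrow> w = replicate m Down" for w m
  proof (induction w arbitrary: m)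
    case (Cons s w)
    thus ?case by (cases s; cases m) auto
  qed auto
  have "stays_nonneg a (replicate k Down) \<longleftrightarrow> k \<le> a"
  proof (induction k arbitrary: a)
    case (Suc k)
    show ?case by (cases a) (simp_all add: Suc)
  qed simp
  moreover have "nonneg_paths a 0 k = {w. w = replicate k Down \<and> stays_nonneg a w}"
    unfolding nonneg_paths_def *[symmetric] by blast
  ultimately show ?thesis by auto
qed

lemma nonneg_paths_no_downs: "nonneg_paths a u 0 = {replicate u Up}"
proof -
  have *: "downs w = 0 \<and> ups w = m \<longleftrightarrow> w = replicate m Up" for w m
  proof (induction w arbitrary: m)
    case (Cons s w)
    thus ?case by (cases s; cases m) auto
  qed auto
  have "stays_nonneg a (replicate u Up)"
    by (induction u arbitrary: a) auto
  moreover have "nonneg_paths a u 0 = {w. w = replicate u Up \<and> stays_nonneg a w}"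
    unfolding nonneg_paths_def *[symmetric] by blast
  ultimately show ?thesis by auto
qed

lemma card_nonneg_paths_first_step:
  "card (nonneg_paths a (Suc u) (Suc k)) =
     card (nonneg_paths (Suc a) u (Suc k)) +
     (if 0 < a then card (nonneg_paths (a - 1) (Suc u) k) else 0)"
proof -
  let ?A = "Cons Up ` nonneg_paths (Suc a) u (Suc k)"
  let ?B = "if 0 < a then Cons Down ` nonneg_paths (a - 1) (Suc u) k else {}"
  have "w \<in> nonneg_paths a (Suc u) (Suc k) \<longleftrightarrow> w \<in> ?A \<union> ?B" for w
  proof (cases w)
    case (Cons s v)
    thus ?thesis by (cases s) (auto simp: nonneg_paths_def)
  qed (auto simp: nonneg_paths_def)
  hence "nonneg_paths a (Suc u) (Suc k) = ?A \<union> ?B" by blast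
  moreover have "card (?A \<union> ?B) = card ?A + card ?B"
    by (intro card_Un_disjoint) (auto simp: finite_nonneg_paths)
  ultimately show ?thesis by (simp add: card_image)
qed

text \<open>The reflection principle: among all words with \<open>u\<close> up-steps and \<open>k\<close> down-steps, those that drop
below zero from \<open>a\<close> correspond, by flipping their steps up to the first visit to \<open>-1\<close>, to all words
of the same length with \<open>a + u + 1\<close> up-steps. Instead of this bijection, the proof checks that the binomials satisfy
the first-step recursion, by Pascal's rule. The bound on \<open>k\<close> says that the end height is at least
\<open>-1\<close>; below that, every word drops below zero and the correspondence fails.\<close>

lemma card_nonneg_paths:
  "k \<le> Suc (a + u) \<Longrightarrow>
     card (nonneg_paths a u k) + ((u + k) choose Suc (a + u)) = (u + k) choose u"
proof (induction "u + k" arbitrary: a u k)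
  case 0
  thus ?case by (simp add: nonneg_paths_no_downs)
next
  case (Suc m)
  show ?case
  proof (cases "u = 0 \<or> k = 0")
    case True
    thus ?thesis
    proof
      assume "u = 0"
      with Suc.prems show ?thesis
        by (cases "k = Suc a") (auto simp: nonneg_paths_no_ups binomial_eq_0)
    next
      assume "k = 0"
      thus ?thesis by (simp add: nonneg_paths_no_downs binomial_eq_0)
    qed
  next
    case False
    then obtain u' k' where uk: "u = Suc u'" "k = Suc k'" by (meson not0_implies_Suc)
    have up: "card (nonneg_paths (Suc a) u' k) + ((u' + k) choose Suc (Suc a + u')) = (u' + k) choose u'"
      using Suc uk by (intro Suc.hyps) auto
    have "(if 0 < a then card (nonneg_paths (a - 1) u k') else 0) + ((u + k') choose (a + u)) = (u + k') choose u"
    proof (cases a)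
      case (Suc b)
      have "card (nonneg_paths b u k') + ((u + k') choose Suc (b + u)) = (u + k') choose u"
        using Suc.hyps Suc.prems uk Suc by (intro Suc.hyps) auto
      thus ?thesis using Suc by simp
    qed simp
    with up show ?thesis
      unfolding uk card_nonneg_paths_first_step by simp
  qed
qed

section \<open>Dyck paths through a marked step\<close>

text \<open>The event seen as a cut \<open>w = v @ s # x\<close>: it depends only on the numbers of up- and down-steps of
\<open>v\<close>. An up-step has its highest point at its end and a down-step at its start, whence the summand
\<open>ups [s]\<close>.\<close>

lemma step_height_event_iff:
  assumes "1 \<le> r"
  shows "(\<exists>i. is_nth_step s r w i \<and> step_height w i = int d) \<longleftrightarrow>
         (\<exists>v x. w = v @ s # x \<and> Suc (count_list v s) = r \<and>
            int (ups v) - int (downs v) + int (ups [s]) = int d)"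
proof -
  have count: "card {j. j \<le> length v \<and> (v @ s # x) ! j = s} = Suc (count_list v s)" for v x
  proof -
    have "{j. j \<le> length v \<and> (v @ s # x) ! j = s} =
          insert (length v) {j. j < length v \<and> v ! j = s}"
      by (auto simp: nth_append)
    moreover have "card {j. j < length v \<and> v ! j = s} = count_list v s"
      by (simp add: count_list_eq_length_filter length_filter_conv_card eq_commute)
    ultimately show ?thesis by simp
  qed
  have height: "step_height (v @ s # x) (length v) =
      int (ups v) - int (downs v) + int (ups [s])" for v x
    by (cases s) (auto simp: step_height_def path_point_eq)
  show ?thesis
  proof
    assume "\<exists>i. is_nth_step s r w i \<and> step_height w i = int d"
    then obtain i where i: "is_nth_step s r w i" "step_height w i = int d" by blast
    hence "i < length w" "w ! i = s" by (auto simp: is_nth_step_def)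
    then obtain v x where w: "w = v @ s # x" "i = length v"
      by (metis id_take_nth_drop length_take less_imp_le min_absorb2)
    show "\<exists>v x. w = v @ s # x \<and> Suc (count_list v s) = r \<and>
            int (ups v) - int (downs v) + int (ups [s]) = int d"
      using i w height[of v x] count[of v x] by (auto simp: is_nth_step_def)
  next
    assume "\<exists>v x. w = v @ s # x \<and> Suc (count_list v s) = r \<and>
            int (ups v) - int (downs v) + int (ups [s]) = int d"
    then obtain v x where w: "w = v @ s # x" "Suc (count_list v s) = r"
      "int (ups v) - int (downs v) + int (ups [s]) = int d" by blast
    hence "is_nth_step s r w (length v) \<and> step_height w (length v) = int d"
      using height[of v x] count[of v x] by (auto simp: is_nth_step_def)
    thus "\<exists>i. is_nth_step s r w i \<and> step_height w i = int d" by blast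
  qed
qed

text \<open>The cut is unique because \<open>v\<close> has the known length \<open>u + k\<close>, so prefixes and completions can be
chosen independently.\<close>

lemma card_marked_dyck_paths:
  fixes u k :: nat and s :: step
  defines "u' \<equiv> u + ups [s]" and "k' \<equiv> k + downs [s]"
  assumes "k \<le> u" "k' \<le> u'" "u' \<le> n"
  shows "card {w \<in> dyck_paths n. \<exists>v x. w = v @ s # x \<and> ups v = u \<and> downs v = k} =
         card (nonneg_paths 0 u k) * card (nonneg_paths (u' - k') (n - u') (n - k'))"
proof -
  let ?P = "nonneg_paths 0 u k" and ?Q = "nonneg_paths (u' - k') (n - u') (n - k')"
  have iff: "v @ s # x \<in> dyck_paths n \<and> ups v = u \<and> downs v = k \<longleftrightarrow> v \<in> ?P \<and> x \<in> ?Q" for v x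
    using assms
    by (cases s) (auto simp: dyck_paths_eq nonneg_paths_def stays_nonneg_append Suc_diff_le)
  have "{w \<in> dyck_paths n. \<exists>v x. w = v @ s # x \<and> ups v = u \<and> downs v = k} =
        (\<lambda>(v, x). v @ s # x) ` (?P \<times> ?Q)"
    using iff by (auto simp: image_iff) blast+
  moreover have "inj_on (\<lambda>(v, x). v @ s # x) (?P \<times> ?Q)"
    by (auto simp: inj_on_def nonneg_paths_def length_eq_ups_plus_downs)
  ultimately show ?thesis by (simp add: card_image card_cartesian_product)
qed

section \<open>Asymptotic number of completions\<close>

definition catalan :: "nat \<Rightarrow> nat" where
  "catalan n = card (dyck_paths n)"

lemma catalan_pos: "0 < catalan n"
  using finite_dyck_paths dyck_paths_nonempty by (simp add: catalan_def card_gt_0_iff)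

lemma catalan_times_Suc: "Suc n * catalan n = (2 * n) choose n"
proof -
  let ?c = "(2 * n) choose n" and ?b = "(2 * n) choose Suc n"
  have "catalan n + ?b = ?c"
    using card_nonneg_paths[of n 0 n] by (simp add: catalan_def dyck_paths_eq mult_2)
  hence "Suc n * catalan n + Suc n * ?b = Suc n * ?c"
    by (metis add_mult_distrib2)
  moreover have "Suc n * ?b = n * ?c"
  proof -
    have "Suc n * ?b = (2 * n) * ((2 * n - 1) choose n)" by (rule binomial_absorption)
    also have "\<dots> = (2 * n - n) * ?c" by (rule binomial_absorb_comp[symmetric])
    finally show ?thesis by simp
  qed
  ultimately have "Suc n * catalan n + n * ?c = ?c + n * ?c" by simp
  thus ?thesis by (simp only: add_right_cancel)
qed

text \<open>The ratio of consecutive Catalan numbers comes from the ratio of consecutive central binomial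
coefficients.\<close>

lemma catalan_Suc: "(n + 2) * catalan (Suc n) = (4 * n + 2) * catalan n"
proof -
  have "Suc n * Suc n * ((2 * Suc n) choose Suc n) = Suc n * (4 * n + 2) * ((2 * n) choose n)"
  proof -
    have 1: "Suc n * (Suc (Suc (2 * n)) choose Suc n) = Suc (Suc (2 * n)) * (Suc (2 * n) choose n)"
      by (rule Suc_times_binomial)
    have 2: "Suc n * (Suc (2 * n) choose Suc n) = Suc (2 * n) * ((2 * n) choose n)"
      by (rule Suc_times_binomial)
    have 3: "Suc (2 * n) choose n = Suc (2 * n) choose Suc n"
      using binomial_symmetric[of n "Suc (2 * n)"] by simp
    have "Suc n * Suc n * (Suc (Suc (2 * n)) choose Suc n)
         = Suc (Suc (2 * n)) * (Suc n * (Suc (2 * n) choose Suc n))"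
      using 1 3 by (metis mult.assoc mult.left_commute)
    also have "\<dots> = Suc (Suc (2 * n)) * (Suc (2 * n) * ((2 * n) choose n))" by (simp only: 2)
    also have "\<dots> = Suc n * (4 * n + 2) * ((2 * n) choose n)" by (simp add: algebra_simps)
    finally show ?thesis by simp
  qed
  also have "\<dots> = Suc n * Suc n * ((4 * n + 2) * catalan n)"
    unfolding catalan_times_Suc[of n, symmetric] by (simp only: mult_ac)
  finally have "(Suc n * Suc n) * ((n + 2) * catalan (Suc n)) = (Suc n * Suc n) * ((4 * n + 2) * catalan n)"
    unfolding catalan_times_Suc[of "Suc n", symmetric] by (simp only: add_2_eq_Suc')
  thus ?thesis by (subst (asm) mult_left_cancel) simp_all
qed

lemma catalan_ratio_Suc: "(\<lambda>n. real (catalan n) / real (catalan (Suc n))) \<longlonglongrightarrow> 1 / 4"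
proof -
  have "real (catalan n) / real (catalan (Suc n)) = (1 + 2 / real n) / (4 + 2 / real n)" if "0 < n" for n
  proof -
    have "real (n + 2) * real (catalan (Suc n)) = real (4 * n + 2) * real (catalan n)"
      unfolding of_nat_mult[symmetric] catalan_Suc ..
    hence "real (catalan n) / real (catalan (Suc n)) = real (n + 2) / real (4 * n + 2)"
      using catalan_pos[of "Suc n"] by (simp add: field_simps)
    also have "\<dots> = (1 + 2 / real n) / (4 + 2 / real n)"
    proof -
      have "1 + 2 / real n = real (n + 2) / real n" "4 + 2 / real n = real (4 * n + 2) / real n"
        using that by (simp_all add: field_simps)
      thus ?thesis using that by simp
    qed
    finally show ?thesis .
  qed
  moreover have "(\<lambda>n. (1 + 2 / real n) / (4 + 2 / real n)) \<longlonglongrightarrow> (1 + 0) / (4 + 0)"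
    by (intro tendsto_intros lim_const_over_n) auto
  ultimately show ?thesis
    by (subst tendsto_cong[OF eventually_mono[OF eventually_gt_at_top[of 0]]]) auto
qed

lemma catalan_ratio: "(\<lambda>n. real (catalan (n - k)) / real (catalan n)) \<longlonglongrightarrow> (1 / 4) ^ k"
proof -
  have "(\<lambda>n. real (catalan n) / real (catalan (n + k))) \<longlonglongrightarrow> (1 / 4) ^ k"
  proof (induction k)
    case 0
    show ?case using catalan_pos by (simp add: less_imp_neq[symmetric])
  next
    case (Suc k)
    have "(\<lambda>n. real (catalan (n + k)) / real (catalan (Suc (n + k)))) \<longlonglongrightarrow> 1 / 4"
      using LIMSEQ_ignore_initial_segment[OF catalan_ratio_Suc, of k] by simp
    from tendsto_mult[OF this Suc] show ?case
      using catalan_pos by (simp add: less_imp_neq[symmetric])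
  qed
  hence "(\<lambda>n. real (catalan (n + k - k)) / real (catalan (n + k))) \<longlonglongrightarrow> (1 / 4) ^ k" by simp
  thus ?thesis by (rule LIMSEQ_offset)
qed

text \<open>After \<open>h + k\<close> up-steps and \<open>k\<close> down-steps a path has height \<open>h\<close>. Its completions split by their
first step into those from height \<open>h + 1\<close> and, if \<open>h > 0\<close>, those from height \<open>h - 1\<close>. Read backwards,
this recursion expresses the count for \<open>h + 1\<close> by the counts for \<open>h\<close> and \<open>h - 1\<close>, so all limits
follow from those at \<open>h = 0\<close>, which are ratios of Catalan numbers. The factor \<open>h + 1\<close> is the
harmonic function of the walk killed at \<open>-1\<close>.\<close>

lemma completions_tendsto:
  "(\<lambda>n. real (card (nonneg_paths h (n - (h + k)) (n - k))) / real (catalan n))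
     \<longlonglongrightarrow> real (Suc h) / 2 ^ (h + 2 * k)"
proof (induction h arbitrary: k rule: less_induct)
  case (less h)
  show ?case
  proof (cases h)
    case 0
    have "(1 / 4 :: real) ^ k = 1 / 2 ^ (2 * k)" by (simp add: power_mult power_divide)
    thus ?thesis using catalan_ratio[of k] 0 by (simp add: catalan_def dyck_paths_eq)
  next
    case (Suc g)
    let ?f = "\<lambda>h k n. real (card (nonneg_paths h (n - (h + k)) (n - k))) / real (catalan n)"
    \<comment> \<open>The limit for height \<open>g - 1 = h - 2\<close> after one more down-step.\<close>
    define L where "L = (if 0 < g then real g / 2 ^ (g - 1 + 2 * Suc k) else 0)"
    have rec: "eventually (\<lambda>n. ?f h k n = ?f g k n - (if 0 < g then ?f (g - 1) (Suc k) n else 0)) sequentially"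
      using eventually_gt_at_top[of "h + k"]
    proof eventually_elim
      case (elim n)
      define u l where "u = n - Suc (g + k)" and "l = n - Suc k"
      have ul: "n - (g + k) = Suc u" "n - k = Suc l" "n - (h + k) = u"
        "0 < g \<Longrightarrow> n - (g - 1 + Suc k) = Suc u" "n - Suc k = l"
        using elim Suc by (auto simp: u_def l_def)
      have f1: "?f h k n = real (card (nonneg_paths h u (Suc l))) / real (catalan n)"
        by (simp only: ul)
      have f2: "?f g k n = real (card (nonneg_paths g (Suc u) (Suc l))) / real (catalan n)"
        by (simp only: ul)
      have f3: "0 < g \<Longrightarrow> ?f (g - 1) (Suc k) n =
          real (card (nonneg_paths (g - 1) (Suc u) l)) / real (catalan n)"
        by (simp only: ul)
      show ?case
      proof (cases "0 < g")
        case True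
        have "real (card (nonneg_paths h u (Suc l))) =
            real (card (nonneg_paths g (Suc u) (Suc l))) - real (card (nonneg_paths (g - 1) (Suc u) l))"
          using card_nonneg_paths_first_step[of g u l] Suc True by simp
        thus ?thesis by (simp only: f1 f2 f3[OF True] True if_True diff_divide_distrib)
      next
        case False
        have "card (nonneg_paths h u (Suc l)) = card (nonneg_paths g (Suc u) (Suc l))"
          using card_nonneg_paths_first_step[of g u l] Suc False by simp
        thus ?thesis by (simp only: f1 f2 False if_False diff_zero)
      qed
    qed
    have "(\<lambda>n. if 0 < g then ?f (g - 1) (Suc k) n else 0) \<longlonglongrightarrow> L"
      using less[of "g - 1" "Suc k"] Suc by (cases g) (auto simp: L_def)
    with less[of g k] Suc have "(\<lambda>n. ?f g k n - (if 0 < g then ?f (g - 1) (Suc k) n else 0))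
        \<longlonglongrightarrow> real (Suc g) / 2 ^ (g + 2 * k) - L"
      by (intro tendsto_diff) auto
    moreover have "real (Suc g) / 2 ^ (g + 2 * k) - L = real (Suc h) / 2 ^ (h + 2 * k)"
      using Suc by (cases g) (auto simp: L_def field_simps)
    ultimately show ?thesis using tendsto_cong[OF rec] by simp
  qed
qed

section \<open>The limiting height distribution\<close>

definition ballot :: "nat \<Rightarrow> nat \<Rightarrow> nat" where
  "ballot h k = card (nonneg_paths 0 (h + k) k)"

lemma step_height_prob_eq:
  assumes "1 \<le> r"
  shows "step_height_prob s r d n =
     real (card {w \<in> dyck_paths n. \<exists>v x. w = v @ s # x \<and> Suc (count_list v s) = r \<and>
            int (ups v) - int (downs v) + int (ups [s]) = int d}) / real (catalan n)"
  using finite_dyck_paths dyck_paths_nonempty assms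
  by (simp add: step_height_prob_def measure_pmf_of_set step_height_event_iff catalan_def
      Int_def)

text \<open>The up-step starts at height \<open>h\<close> after \<open>h + k\<close> up-steps and \<open>k\<close> down-steps, hence has index
\<open>h + k + 1\<close> and height \<open>h + 1\<close>.\<close>

lemma step_height_prob_Up_tendsto:
  "(\<lambda>n. step_height_prob Up (Suc (h + k)) (Suc h) n)
     \<longlonglongrightarrow> real (ballot h k) * (real (h + 2) / 2 ^ (Suc h + 2 * k))"
proof -
  have "eventually (\<lambda>n. real (ballot h k) * (real (card (nonneg_paths (Suc h) (n - (Suc h + k)) (n - k)))
     / real (catalan n)) = step_height_prob Up (Suc (h + k)) (Suc h) n) sequentially"
    using eventually_gt_at_top[of "h + k"]
  proof eventually_elim
    case (elim n)
    have "(Suc (count_list v Up) = Suc (h + k) \<and> int (ups v) - int (downs v) + int (ups [Up]) = int (Suc h))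
        \<longleftrightarrow> ups v = h + k \<and> downs v = k" for v
      by auto
    hence "step_height_prob Up (Suc (h + k)) (Suc h) n =
        real (card {w \<in> dyck_paths n. \<exists>v x. w = v @ Up # x \<and> ups v = h + k \<and> downs v = k}) / real (catalan n)"
      by (subst step_height_prob_eq) simp_all
    thus ?case using elim
      by (subst (asm) card_marked_dyck_paths) (simp_all add: ballot_def)
  qed
  moreover have "(\<lambda>n. real (ballot h k) * (real (card (nonneg_paths (Suc h) (n - (Suc h + k)) (n - k)))
     / real (catalan n))) \<longlonglongrightarrow> real (ballot h k) * (real (Suc (Suc h)) / 2 ^ (Suc h + 2 * k))"
    by (intro tendsto_mult tendsto_const completions_tendsto)
  ultimately show ?thesis by (auto dest: tendsto_cong)
qed

text \<open>The down-step starts at height \<open>h + 1\<close>, which is its height, after \<open>k\<close> down-steps.\<close>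

lemma step_height_prob_Down_tendsto:
  "(\<lambda>n. step_height_prob Down (Suc k) (Suc h) n)
     \<longlonglongrightarrow> real (ballot (Suc h) k) * (real (Suc h) / 2 ^ (h + 2 * Suc k))"
proof -
  have "eventually (\<lambda>n. real (ballot (Suc h) k) * (real (card (nonneg_paths h (n - (h + Suc k)) (n - Suc k)))
     / real (catalan n)) = step_height_prob Down (Suc k) (Suc h) n) sequentially"
    using eventually_gt_at_top[of "h + k"]
  proof eventually_elim
    case (elim n)
    have "(Suc (count_list v Down) = Suc k \<and> int (ups v) - int (downs v) + int (ups [Down]) = int (Suc h))
        \<longleftrightarrow> ups v = Suc h + k \<and> downs v = k" for v
      by auto
    hence "step_height_prob Down (Suc k) (Suc h) n =
        real (card {w \<in> dyck_paths n. \<exists>v x. w = v @ Down # x \<and> ups v = Suc h + k \<and> downs v = k}) / real (catalan n)"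
      by (subst step_height_prob_eq) simp_all
    thus ?case using elim
      by (subst (asm) card_marked_dyck_paths) (simp_all add: ballot_def)
  qed
  moreover have "(\<lambda>n. real (ballot (Suc h) k) * (real (card (nonneg_paths h (n - (h + Suc k)) (n - Suc k)))
     / real (catalan n))) \<longlonglongrightarrow> real (ballot (Suc h) k) * (real (Suc h) / 2 ^ (h + 2 * Suc k))"
    by (intro tendsto_mult tendsto_const completions_tendsto)
  ultimately show ?thesis by (auto dest: tendsto_cong)
qed

text \<open>Every step of a Dyck path has height at least 1, and the \<open>r\<close>-th up-step ends at height at most \<open>r\<close>.\<close>

lemma step_height_prob_impossible:
  assumes "1 \<le> r" "d = 0 \<or> (s = Up \<and> r < d)"
  shows "step_height_prob s r d = (\<lambda>n. 0)"
proof
  fix n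
  have "False" if "v @ s # x \<in> dyck_paths n" "Suc (count_list v s) = r"
    "int (ups v) - int (downs v) + int (ups [s]) = int d" for v x
  proof -
    have "stays_nonneg 0 v" "stays_nonneg 0 (v @ [s])"
      using that(1) stays_nonneg_append[of 0 "v @ [s]" x]
      by (auto simp: dyck_paths_eq nonneg_paths_def stays_nonneg_append)
    hence "downs v \<le> ups v" "downs (v @ [s]) \<le> ups (v @ [s])"
      using downs_le_if_stays_nonneg by fastforce+
    thus False using that assms by (cases s) auto
  qed
  hence "{w \<in> dyck_paths n. \<exists>v x. w = v @ s # x \<and> Suc (count_list v s) = r \<and>
            int (ups v) - int (downs v) + int (ups [s]) = int d} = {}"
    by blast
  thus "step_height_prob s r d n = 0"
    unfolding step_height_prob_eq[OF assms(1)] by (simp only: card.empty of_nat_0 div_0)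
qed

lemma step_height_prob_Up_limit:
  assumes "1 \<le> r"
  shows "(\<lambda>n. step_height_prob Up r d n) \<longlonglongrightarrow>
     (if 1 \<le> d \<and> d \<le> r then real (ballot (d - 1) (r - d)) * (real (d + 1) / 2 ^ (d + 2 * (r - d))) else 0)"
proof (cases "1 \<le> d \<and> d \<le> r")
  case True
  thus ?thesis using step_height_prob_Up_tendsto[of "d - 1" "r - d"] by simp
next
  case False
  thus ?thesis using assms step_height_prob_impossible[of r d Up] by auto
qed

lemma step_height_prob_Down_limit:
  assumes "1 \<le> r"
  shows "(\<lambda>n. step_height_prob Down r d n) \<longlonglongrightarrow>
     real (ballot d (r - 1)) * (real d / 2 ^ (d + 2 * (r - 1) + 1))"
proof (cases "d = 0")
  case False
  then obtain h k where "d = Suc h" "r = Suc k"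
    using assms by (metis Suc_le_D One_nat_def not0_implies_Suc)
  thus ?thesis using step_height_prob_Down_tendsto[of k h] by simp
next
  case True
  thus ?thesis using assms step_height_prob_impossible[of r d Down] by auto
qed

section \<open>Generating functions\<close>

lemma ballot_0_right: "ballot h 0 = 1"
  by (simp add: ballot_def nonneg_paths_no_downs)

lemma ballot_closed_form:
  "real (ballot h k) = real ((h + 2 * k) choose (h + k)) - real ((h + 2 * k) choose Suc (h + k))"
proof -
  have "ballot h k + ((h + 2 * k) choose Suc (h + k)) = (h + 2 * k) choose (h + k)"
    using card_nonneg_paths[of k 0 "h + k"] by (simp add: ballot_def mult_2 add.assoc)
  thus ?thesis by (metis add_diff_cancel_right' of_nat_add)
qed

text \<open>A nonnegative word of final height \<open>h + 1\<close> arrives there from height \<open>h\<close> or from height \<open>h + 2\<close>;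
the next lemma is the case of final height 0. Both follow from the closed form by Pascal's rule, the
second one together with the symmetry of the binomial coefficients.\<close>

lemma ballot_last_step:
  "real (ballot (Suc h) (Suc k)) = real (ballot h (Suc k)) + real (ballot (Suc (Suc h)) k)"
proof -
  define N j where "N = Suc (Suc (h + 2 * k))" and "j = Suc (h + k)"
  have "Suc h + 2 * Suc k = Suc N" "h + 2 * Suc k = N" "Suc (Suc h) + 2 * k = N"
    "Suc h + Suc k = Suc j" "h + Suc k = j" "Suc (Suc h) + k = Suc j"
    by (simp_all add: N_def j_def)
  thus ?thesis by (simp only: ballot_closed_form binomial_Suc_Suc of_nat_add)
qed

lemma ballot_0_Suc: "real (ballot 0 (Suc k)) = real (ballot 1 k)"
proof -
  define N where "N = Suc (2 * k)"
  have "N choose k = N choose Suc k"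
    using binomial_symmetric[of k N] by (simp add: N_def)
  moreover have "0 + 2 * Suc k = Suc N" "1 + 2 * k = N" "0 + Suc k = Suc k" "1 + k = Suc k"
    by (simp_all add: N_def)
  ultimately show ?thesis by (simp only: ballot_closed_form binomial_Suc_Suc of_nat_add)
qed

definition sqrt_fps :: "real fps" where
  "sqrt_fps = fps_radical root 2 (1 - fps_X)"

lemma sqrt_fps_squared: "sqrt_fps ^ 2 = 1 - fps_X"
  using power_radical[of "1 - fps_X :: real fps" root 1]
  by (simp add: sqrt_fps_def numeral_2_eq_2)

text \<open>The Catalan series \<open>C(z) = (1 - sqrt (1 - 4 z)) / (2 z)\<close> at \<open>z = x / 4\<close>, in a form whose denominator
is a unit.\<close>

definition cat_fps :: "real fps" where
  "cat_fps = 2 * inverse (1 + sqrt_fps)"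

lemma cat_fps_times: "cat_fps * (1 + sqrt_fps) = 2"
proof -
  have "fps_nth (1 + sqrt_fps) 0 \<noteq> 0" by (simp add: sqrt_fps_def)
  thus ?thesis by (simp add: cat_fps_def mult.assoc inverse_mult_eq_1)
qed

lemma cat_fps_eq: "cat_fps = 1 + fps_const (1 / 4) * fps_X * cat_fps ^ 2"
proof -
  have X: "fps_X = (1 - sqrt_fps) * (1 + sqrt_fps)"
    using sqrt_fps_squared by (simp add: algebra_simps power2_eq_square)
  have 4: "fps_const (1 / 4) * 4 = (1 :: real fps)"
    by (simp add: numeral_fps_const)
  have "fps_const (1 / 4) * fps_X * cat_fps ^ 2
     = fps_const (1 / 4) * (1 - sqrt_fps) * (cat_fps * (1 + sqrt_fps)) * cat_fps"
    by (simp add: X power2_eq_square)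
  also have "\<dots> = fps_const (1 / 4) * 2 * (2 * cat_fps - cat_fps * (1 + sqrt_fps))"
    unfolding cat_fps_times by (simp add: algebra_simps cat_fps_times flip: cat_fps_times)
  also have "\<dots> = fps_const (1 / 4) * 4 * (cat_fps - 1)"
    unfolding cat_fps_times by (simp add: algebra_simps)
  finally show ?thesis unfolding 4 by simp
qed

text \<open>By its quadratic equation, the powers \<open>C^(h + 1)\<close> of \<open>C = cat_fps\<close> satisfy
\<open>C^(h + 1) = C^h + x / 4 * C^(h + 2)\<close>. This is the last-step recursion of the ballot numbers, with
weight \<open>1 / 4\<close> for each down-step, and it determines the coefficients by induction on \<open>k\<close> and then
on \<open>h\<close>.\<close>

lemma cat_fps_power_nth: "fps_nth (cat_fps ^ Suc h) k = real (ballot h k) / 4 ^ k"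
proof (induction k arbitrary: h)
  case 0
  have "fps_nth cat_fps 0 = 1"
    using arg_cong[OF cat_fps_eq, of "\<lambda>f. fps_nth f 0"] by simp
  thus ?case by (simp add: ballot_0_right fps_nth_power_0)
next
  case (Suc k)
  have rec: "fps_nth (cat_fps ^ Suc m) (Suc k) = fps_nth (cat_fps ^ m) (Suc k) + real (ballot (Suc m) k) / 4 ^ Suc k" for m
  proof -
    have "cat_fps ^ Suc m = cat_fps ^ m * (1 + fps_const (1 / 4) * fps_X * cat_fps ^ 2)"
      using cat_fps_eq by simp
    also have "\<dots> = cat_fps ^ m + fps_const (1 / 4) * (fps_X * cat_fps ^ Suc (Suc m))"
      by (simp add: algebra_simps power2_eq_square)
    finally have "fps_nth (cat_fps ^ Suc m) (Suc k) =
        fps_nth (cat_fps ^ m + fps_const (1 / 4) * (fps_X * cat_fps ^ Suc (Suc m))) (Suc k)"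
      by (rule arg_cong)
    thus ?thesis by (simp add: Suc del: power_Suc) simp
  qed
  show ?case
  proof (induction h)
    case 0
    show ?case using rec[of 0] ballot_0_Suc[of k] by simp
  next
    case (Suc h)
    show ?case using rec[of "Suc h"] Suc ballot_last_step[of h k] by (simp add: add_divide_distrib)
  qed
qed

text \<open>The limits are summed over \<open>r\<close> first, for fixed \<open>d\<close>, whereas the outer variable of \<open>height_gf\<close> is
\<open>x\<close>. The computations therefore take place in power series in \<open>y\<close> over power series in \<open>x\<close> and are
carried over by this ring homomorphism.\<close>

definition swap_vars :: "'a::comm_ring_1 fps fps \<Rightarrow> 'a fps fps" where
  "swap_vars f = Abs_fps (\<lambda>i. Abs_fps (\<lambda>j. fps_nth (fps_nth f j) i))"

lemma swap_vars_add: "swap_vars (f + g) = swap_vars f + swap_vars g"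
  by (simp add: swap_vars_def fps_eq_iff)

lemma swap_vars_diff: "swap_vars (f - g) = swap_vars f - swap_vars g"
  by (simp add: swap_vars_def fps_eq_iff)

lemma swap_vars_1: "swap_vars 1 = 1"
  by (simp add: swap_vars_def fps_eq_iff)

lemma swap_vars_mult: "swap_vars (f * g) = swap_vars f * swap_vars g"
proof -
  have "(\<Sum>a=0..j. \<Sum>b=0..i. fps_nth (fps_nth f a) b * fps_nth (fps_nth g (j - a)) (i - b)) =
        (\<Sum>b=0..i. \<Sum>a=0..j. fps_nth (fps_nth f a) b * fps_nth (fps_nth g (j - a)) (i - b))" for i j
    by (rule sum.swap)
  thus ?thesis by (simp add: swap_vars_def fps_eq_iff fps_mult_nth fps_sum_nth)
qed

lemma swap_vars_power: "swap_vars (f ^ n) = swap_vars f ^ n"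
  by (induction n) (auto simp: swap_vars_1 swap_vars_mult)

lemma swap_vars_X: "swap_vars fps_X = yvar"
  by (simp add: swap_vars_def yvar_def fps_eq_iff fps_X_def)

lemma swap_vars_const_X: "swap_vars (fps_const fps_X) = xvar"
  by (simp add: swap_vars_def xvar_def fps_eq_iff fps_X_def)

lemma swap_vars_const_sqrt: "swap_vars (fps_const sqrt_fps) = sqrt_one_minus_x"
  by (simp add: swap_vars_def sqrt_one_minus_x_def sqrt_fps_def fps_eq_iff)

definition geometric :: "'a::comm_ring_1 \<Rightarrow> 'a fps" where
  "geometric t = Abs_fps (\<lambda>d. t ^ d)"

lemma geometric_times: "(1 - fps_const t * fps_X) * geometric t = 1"
proof (rule fps_ext)
  fix n show "fps_nth ((1 - fps_const t * fps_X) * geometric t) n = fps_nth 1 n"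
    by (cases n) (simp_all add: algebra_simps geometric_def mult.assoc)
qed

lemma geometric_squared_nth: "fps_nth (geometric t ^ 2) d = of_nat (Suc d) * t ^ d"
  by (simp add: power2_eq_square fps_mult_nth geometric_def flip: power_add)

text \<open>Coefficient of \<open>y^d\<close>: \<open>(d + 1) (x C / 2)^d\<close>, where \<open>x^d\<close> shifts \<open>r - d\<close> to \<open>r\<close>. The term 1 removes
\<open>d = 0\<close>, for which no up-step exists but the formula gives 1.\<close>

lemma height_gf_Up_swapped:
  "height_gf Up = swap_vars (geometric (fps_X * fps_const (1 / 2) * cat_fps) ^ 2 - 1)"
proof -
  have "(if 1 \<le> r then limit_height_prob Up r d else 0) =
    fps_nth (fps_nth (geometric (fps_X * fps_const (1 / 2) * cat_fps) ^ 2 - 1) d) r" for r d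
  proof (cases "d = 0")
    case True
    have "limit_height_prob Up r 0 = 0" if "1 \<le> r"
      unfolding limit_height_prob_def using step_height_prob_Up_limit[OF that, of 0] limI by force
    thus ?thesis using True by (simp add: geometric_squared_nth)
  next
    case False
    then obtain h where d: "d = Suc h" by (cases d) auto
    have "fps_nth (fps_nth (geometric (fps_X * fps_const (1 / 2) * cat_fps) ^ 2 - 1) d) r
      = fps_nth (fps_X ^ d * (fps_const (real (Suc d) * (1 / 2) ^ d) * cat_fps ^ d)) r"
      using False
      by (simp add: geometric_squared_nth power_mult_distrib fps_const_power mult_ac
          flip: fps_const_mult fps_of_nat)
    also have "\<dots> = (if r < d then 0 else real (Suc d) * (1 / 2) ^ d * fps_nth (cat_fps ^ d) (r - d))"
      by (simp add: fps_X_power_mult_nth)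
    also have "\<dots> = (if r < d then 0 else real (ballot (d - 1) (r - d)) * (real (d + 1) / 2 ^ (d + 2 * (r - d))))"
      unfolding d cat_fps_power_nth by (simp add: power_add power_mult field_simps)
    also have "\<dots> = (if 1 \<le> r then limit_height_prob Up r d else 0)"
      using step_height_prob_Up_limit[of r d, THEN limI] False by (auto simp: limit_height_prob_def)
    finally show ?thesis ..
  qed
  thus ?thesis by (simp add: height_gf_def swap_vars_def)
qed

text \<open>Coefficient of \<open>y^d\<close>: \<open>x d (C / 2)^(d + 1)\<close>, where the factor \<open>x\<close> shifts \<open>r - 1\<close> to \<open>r\<close>.\<close>

lemma height_gf_Down_swapped:
  "height_gf Down = swap_vars (fps_const fps_X * fps_X * fps_const (fps_const (1 / 2) * cat_fps) ^ 2
      * geometric (fps_const (1 / 2) * cat_fps) ^ 2)" (is "_ = swap_vars ?G")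
proof -
  have "(if 1 \<le> r then limit_height_prob Down r d else 0) = fps_nth (fps_nth ?G d) r" for r d
  proof (cases d)
    case 0
    have "limit_height_prob Down r 0 = 0" if "1 \<le> r"
      unfolding limit_height_prob_def using step_height_prob_Down_limit[OF that, of 0] limI by force
    thus ?thesis using 0 by (simp add: mult.assoc)
  next
    case (Suc h)
    let ?c = "fps_const (1 / 2) * cat_fps"
    have "?G = fps_X * (fps_const (fps_X * ?c ^ 2) * geometric ?c ^ 2)"
      by (simp add: mult_ac flip: fps_const_mult fps_const_power)
    hence "fps_nth ?G d = fps_nth (fps_X * (fps_const (fps_X * ?c ^ 2) * geometric ?c ^ 2)) (Suc h)"
      by (simp only: Suc)
    also have "\<dots> = fps_X * ?c ^ 2 * (of_nat (Suc h) * ?c ^ h)"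
      by (simp add: geometric_squared_nth del: of_nat_Suc)
    also have "\<dots> = fps_X * (fps_const (real d) * ?c ^ Suc d)"
      unfolding Suc fps_of_nat[symmetric] by (simp only: power2_eq_square power_Suc mult_ac)
    also have "\<dots> = fps_X * (fps_const (real d * (1 / 2) ^ Suc d) * cat_fps ^ Suc d)"
      by (simp only: power_mult_distrib fps_const_power fps_const_mult[symmetric] mult.assoc)
    finally have G: "fps_nth (fps_nth ?G d) r = (if r = 0 then 0 else
        real d * (1 / 2) ^ Suc d * fps_nth (cat_fps ^ Suc d) (r - 1))"
      by (simp del: power_Suc)
    also have "\<dots> = (if r = 0 then 0 else real (ballot d (r - 1)) * (real d / 2 ^ (d + 2 * (r - 1) + 1)))"
      unfolding cat_fps_power_nth by (simp add: power_add power_mult field_simps)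
    also have "\<dots> = (if 1 \<le> r then limit_height_prob Down r d else 0)"
      using step_height_prob_Down_limit[of r d, THEN limI] by (auto simp: limit_height_prob_def)
    finally show ?thesis ..
  qed
  thus ?thesis by (simp add: height_gf_def swap_vars_def)
qed

lemma fps_fps_eq_divideI:
  fixes f g h :: "real fps fps"
  assumes "fps_nth (fps_nth g 0) 0 \<noteq> 0" "h * g = f"
  shows "h = f / g"
proof -
  have "(f / g) * g = h * g" using assms fps_fps_divide_mult_cancel by simp
  moreover have "g \<noteq> 0" using assms(1) by auto
  ultimately show ?thesis by simp
qed

theorem theorem3p7:
  shows "(\<forall>r\<ge>1. \<forall>d. convergent (\<lambda>n. step_height_prob Up r d n)) \<and>
         (\<forall>r\<ge>1. \<forall>d. convergent (\<lambda>n. step_height_prob Down r d n)) \<and>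
         height_gf Up =
           xvar * yvar * (4 - 4 * yvar + xvar * yvar ^ 2) /
           (2 * (1 - yvar) * (1 + sqrt_one_minus_x)
              - 3 * xvar * yvar + 4 * xvar * yvar ^ 2 - xvar ^ 2 * yvar ^ 3) \<and>
         height_gf Down =
           xvar * yvar /
           (2 * (1 - yvar) * (1 + sqrt_one_minus_x) - xvar + yvar ^ 2)"
proof (intro conjI allI impI)
  fix r d :: nat assume "1 \<le> r"
  show "convergent (\<lambda>n. step_height_prob Up r d n)" "convergent (\<lambda>n. step_height_prob Down r d n)"
    using step_height_prob_Up_limit[OF \<open>1 \<le> r\<close>] step_height_prob_Down_limit[OF \<open>1 \<le> r\<close>]
    by (auto simp: convergent_def)
next
  define s where "s = sqrt_one_minus_x"
  \<comment> \<open>The series \<open>1 / (1 + s)\<close>.\<close>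
  define c where "c = swap_vars (fps_const (fps_const (1 / 2) * cat_fps))"
  have x: "xvar = (1 - s) * (1 + s)"
    using sqrt_one_minus_x_squared by (simp add: s_def algebra_simps power2_eq_square)
  have s0: "fps_nth s 0 = 1" by (simp add: s_def sqrt_one_minus_x_nth_0)
  have half: "fps_const (1 / 2) * cat_fps * (1 + sqrt_fps) = 1"
    by (simp add: mult.assoc cat_fps_times numeral_fps_const)
  have c: "c * (1 + s) = 1"
  proof -
    have "c * (1 + s) = swap_vars (fps_const (fps_const (1 / 2) * cat_fps) * (1 + fps_const sqrt_fps))"
      by (simp only: swap_vars_mult swap_vars_add swap_vars_1 c_def s_def swap_vars_const_sqrt)
    also have "fps_const a * (1 + fps_const b) = fps_const (a * (1 + b))" for a b :: "real fps"
      by (simp add: distrib_left)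
    also have "fps_const (1 / 2) * cat_fps * (1 + sqrt_fps) = 1" by (rule half)
    finally show ?thesis by (simp add: swap_vars_1)
  qed
  have xc: "xvar * c = 1 - s"
    using c by (simp add: x mult.assoc mult.commute[of "1 + s"])
  show "height_gf Up =
           xvar * yvar * (4 - 4 * yvar + xvar * yvar ^ 2) /
           (2 * (1 - yvar) * (1 + sqrt_one_minus_x)
              - 3 * xvar * yvar + 4 * xvar * yvar ^ 2 - xvar ^ 2 * yvar ^ 3)"
    unfolding s_def[symmetric]
  proof (rule fps_fps_eq_divideI)
    define G where "G = swap_vars (geometric (fps_X * fps_const (1 / 2) * cat_fps))"
    have "swap_vars ((1 - fps_const (fps_X * fps_const (1 / 2) * cat_fps) * fps_X) *
        geometric (fps_X * fps_const (1 / 2) * cat_fps)) = 1"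
      unfolding geometric_times by (rule swap_vars_1)
    hence "(1 - xvar * c * yvar) * G = 1"
      by (simp add: swap_vars_mult swap_vars_diff swap_vars_1 swap_vars_X swap_vars_const_X c_def G_def
         mult.assoc flip: fps_const_mult)
    hence G: "G * (1 - (1 - s) * yvar) = 1" by (simp add: xc mult.commute)
    have gf: "height_gf Up = G ^ 2 - 1"
      by (simp add: height_gf_Up_swapped G_def swap_vars_diff swap_vars_power swap_vars_1)
    \<comment> \<open>The denominator of the theorem is that of \<open>1 / (1 - y (1 - s))^2 - 1\<close> times a factor that also
      divides the numerator.\<close>
    have den: "2 * (1 - yvar) * (1 + s) - 3 * xvar * yvar + 4 * xvar * yvar ^ 2 - xvar ^ 2 * yvar ^ 3
       = (1 - (1 - s) * yvar) ^ 2 * ((1 + s) * (2 - yvar - s * yvar))"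
      unfolding x by algebra
    have "(G ^ 2 - 1) * (1 - (1 - s) * yvar) ^ 2 = 1 - (1 - (1 - s) * yvar) ^ 2"
      using G by algebra
    thus "height_gf Up * (2 * (1 - yvar) * (1 + s) - 3 * xvar * yvar + 4 * xvar * yvar ^ 2 - xvar ^ 2 * yvar ^ 3)
       = xvar * yvar * (4 - 4 * yvar + xvar * yvar ^ 2)"
      unfolding den gf x by algebra
    show "fps_nth (fps_nth (2 * (1 - yvar) * (1 + s) - 3 * xvar * yvar + 4 * xvar * yvar ^ 2 - xvar ^ 2 * yvar ^ 3) 0) 0 \<noteq> 0"
      by (simp add: fps_nth_power_0 s0 xvar_def yvar_def)
  qed
  show "height_gf Down = xvar * yvar / (2 * (1 - yvar) * (1 + sqrt_one_minus_x) - xvar + yvar ^ 2)"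
    unfolding s_def[symmetric]
  proof (rule fps_fps_eq_divideI)
    define G where "G = swap_vars (geometric (fps_const (1 / 2) * cat_fps))"
    have "swap_vars ((1 - fps_const (fps_const (1 / 2) * cat_fps) * fps_X) *
        geometric (fps_const (1 / 2) * cat_fps)) = 1"
      unfolding geometric_times by (rule swap_vars_1)
    hence G: "(1 - c * yvar) * G = 1"
      by (simp only: swap_vars_mult swap_vars_diff swap_vars_1 swap_vars_X c_def G_def)
    have gf: "height_gf Down = xvar * yvar * c ^ 2 * G ^ 2"
      by (simp only: height_gf_Down_swapped G_def swap_vars_mult swap_vars_power swap_vars_X swap_vars_const_X c_def)
    have "2 * (1 - yvar) * (1 + s) - xvar + yvar ^ 2 = (1 + s - yvar) ^ 2"
      unfolding x by algebra
    moreover have "c * G * (1 + s - yvar) = 1"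
      using c G by algebra
    ultimately show "height_gf Down * (2 * (1 - yvar) * (1 + s) - xvar + yvar ^ 2) = xvar * yvar"
      unfolding gf by algebra
    show "fps_nth (fps_nth (2 * (1 - yvar) * (1 + s) - xvar + yvar ^ 2) 0) 0 \<noteq> 0"
      by (simp add: fps_nth_power_0 s0 xvar_def yvar_def)
  qed
qed

end
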